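(* For nonnegative integers $n,k,K$ let $s(n,k,K)$ be the number of natural tests with cost $n$, exactly $k$ distinct valid answers, and exactly $K$ options. Then, as formal power series, $$\mathcal{S}(x,y,z)=\sum_{n\ge 0}\sum_{k\ge 0}\sum_{K\ge 0}s(n,k,K)\,x^n y^k z^K=\prod_{i=1}^{\infty}\left(\frac{1}{1-x^i z}+(y-1)x^{i^2}z^i\right).$$
   Context: A natural test is a finite multiset of positive integers (its answers, or options, counted with multiplicity; order is irrelevant). The empty test is allowed and has cost $0$ and $0$ options. The cost of a test is the sum of all its answers with multiplicity, so a natural test of cost $n$ is a partition of $n$; the number of options is the number of answers counted with multiplicity. A positive integer $a$ is a valid answer of a natural test if $a$ appears in the test exactly $a$ times. *)

theory Defs
  imports "HOL-Analysis.Analysis" "HOL-Computational_Algebra.Formal_Power_Series"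
begin

definition natural_test :: "nat multiset \<Rightarrow> bool" where
  "natural_test T \<longleftrightarrow> (\<forall>a \<in># T. a > 0)"

definition cost :: "nat multiset \<Rightarrow> nat" where
  "cost T = sum_mset T"

definition option_count :: "nat multiset \<Rightarrow> nat" where
  "option_count T = size T"

text \<open>Positivity is essential: \<open>0\<close> occurs \<open>0\<close> times in every natural test.\<close>

definition valid_answers :: "nat multiset \<Rightarrow> nat set" where
  "valid_answers T = {a. a > 0 \<and> count T a = a}"

definition tests :: "nat \<Rightarrow> nat \<Rightarrow> nat \<Rightarrow> nat multiset set" where
  "tests n k K = {T. natural_test T \<and> cost T = n \<and> card (valid_answers T) = k \<and> option_count T = K}"

definition num_tests :: "nat \<Rightarrow> nat \<Rightarrow> nat \<Rightarrow> nat" where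
  "num_tests n k K = card (tests n k K)"

text \<open>The cardinalities above are those of finite sets.\<close>

lemma finite_valid_answers: "finite (valid_answers T)"
  by (rule finite_subset[OF _ finite_set_mset[of T]])
     (auto simp: valid_answers_def simp flip: count_greater_zero_iff)

lemma finite_tests: "finite (tests n k K)"
proof (rule finite_subset)
  show "tests n k K \<subseteq> multisets_of_size {..n} K"
    by (auto simp: tests_def cost_def option_count_def multisets_of_size_def
             dest: multi_member_split)
  show "finite (multisets_of_size {..n} K)"
    by (rule finite_multisets_of_size) simp
qed

text \<open>
  Power series in \<open>x\<close>, \<open>y\<close>, \<open>z\<close> are iterated univariate series: series in \<open>x\<close> whose
  coefficients are series in \<open>y\<close> whose coefficients are series in \<open>z\<close>. The topology on this
  type is the \<open>x\<close>-adic one. The coefficients are rational, rather than integral, because the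
  library's division of power series needs an inverse operation on the coefficients.
\<close>

type_synonym fps3 = "rat fps fps fps"

definition varx :: fps3 where "varx = fps_X"

definition vary :: fps3 where "vary = fps_const fps_X"

definition varz :: fps3 where "varz = fps_const (fps_const fps_X)"

definition tests_gf :: fps3 where
  "tests_gf = Abs_fps (\<lambda>n. Abs_fps (\<lambda>k. Abs_fps (\<lambda>K. of_nat (num_tests n k K))))"

lemma tests_gf_nth: "fps_nth (fps_nth (fps_nth tests_gf n) k) K = of_nat (num_tests n k K)"
  by (simp add: tests_gf_def)

lemma monomial_nth:
  "fps_nth (fps_nth (fps_nth (varx ^ n * vary ^ k * varz ^ K) n') k') K' =
    (if n' = n \<and> k' = k \<and> K' = K then 1 else 0)"
  by (auto simp: varx_def vary_def varz_def fps_X_power_mult_nth fps_X_power_nth mult.assoc)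

text \<open>
  Since the coefficients of a series in \<open>x\<close> do not form a field here, division is a true inverse
  only for suitable denominators; those that are needed are of this kind.
\<close>

lemma fps3_divide_mult_cancel:
  fixes g :: fps3
  assumes g0: "fps_nth g 0 = 1"
  shows "1 / g * g = 1"
proof -
  have inv1: "inverse (1 :: rat fps fps) = 1"
    by (rule fps_inverse_one') simp
  have "subdegree g = 0"
    by (rule subdegree_eq_0) (simp add: g0)
  then have "1 / g = inverse g"
    by (simp add: fps_divide_def)
  moreover have "inverse g * g = 1"
    unfolding fps_inverse_def[of g] g0 inv1 by (rule fps_left_inverse'[of 1]) (simp_all add: g0)
  ultimately show ?thesis
    by simp
qed

lemma geometric_denominator_inverse:
  assumes "i > 0"
  shows "1 / (1 - varx ^ i * varz) * (1 - varx ^ i * varz) = 1"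
  using assms by (intro fps3_divide_mult_cancel) (simp add: varx_def varz_def fps_X_power_mult_nth)

end

theory Submission
  imports Defs
begin

text \<open>
  A natural test is determined by the multiplicities of the answers \<open>1, 2, \<dots>\<close>, and cost, number of
  options and number of distinct valid answers are sums of contributions of the single answers: an
  answer \<open>i\<close> of multiplicity \<open>c\<close> contributes \<open>i * c\<close> to the cost, \<open>c\<close> to the options, and one valid
  answer precisely if \<open>c = i\<close>. The generating function is therefore a product over \<open>i\<close> of the series
  \<open>\<Sum>c. x ^ (i * c) * z ^ c\<close> in which the term with \<open>c = i\<close> has acquired the additional
  factor \<open>y\<close>. Since that term is \<open>x ^ i\<^sup>2 * z ^ i\<close>, adding \<open>y - 1\<close> times it to the geometric series
  gives the \<open>i\<close>-th factor of the theorem (\<open>answer_factor_nth\<close>).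

  To make this precise for an infinite product, the tests with all answers at most \<open>m\<close> are
  considered. Splitting off all copies of the largest possible answer \<open>m + 1\<close> shows by induction that
  the partial product of the first \<open>m\<close> factors enumerates these tests by weight
  (\<open>partial_product_nth\<close>). An answer never exceeds the cost, so a partial product of
  at least \<open>n\<close> factors already has the right coefficient of \<open>x ^ n\<close>; this is convergence in the
  \<open>x\<close>-adic topology.
\<close>

section \<open>The factor of a single answer\<close>

definition answer_weight :: "nat \<Rightarrow> nat \<Rightarrow> rat fps fps" where
  "answer_weight i c = (if c = i then fps_X else 1) * fps_const fps_X ^ c"

definition answer_factor :: "nat \<Rightarrow> fps3" where
  "answer_factor i = 1 / (1 - varx ^ i * varz) + (vary - 1) * varx ^ (i\<^sup>2) * varz ^ i"

text \<open>
  Inverses are unique in a commutative ring, so it suffices that the geometric series, too, is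
  inverse to the denominator.
\<close>

lemma geometric_factor_nth:
  assumes "i > 0"
  shows "fps_nth (1 / (1 - varx ^ i * varz)) d =
    (if i dvd d then fps_const fps_X ^ (d div i) else 0)"
proof -
  define A :: fps3 where
    "A = Abs_fps (\<lambda>d. if i dvd d then fps_const fps_X ^ (d div i) else 0)"
  have "A * (1 - varx ^ i * varz) = 1"
  proof (rule fps_ext)
    fix d
    have "A * (1 - varx ^ i * varz) = A - fps_X ^ i * (A * fps_const (fps_const fps_X))"
      by (simp add: varx_def varz_def algebra_simps)
    moreover have "d div i = Suc ((d - i) div i)" if "i \<le> d"
      using that assms by (intro le_div_geq)
    moreover have "i dvd d \<longleftrightarrow> i dvd d - i" if "i \<le> d"
      using that by (simp add: dvd_minus_self)
    moreover have "d = 0" if "i dvd d" "d < i"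
      using that by (auto dest: dvd_imp_le)
    ultimately show "fps_nth (A * (1 - varx ^ i * varz)) d = fps_nth 1 d"
      using assms by (auto simp: fps_X_power_mult_nth A_def not_less mult.commute)
  qed
  then have "1 / (1 - varx ^ i * varz) = A"
    using geometric_denominator_inverse[OF assms]
    by (metis (no_types, lifting) mult.assoc mult.commute mult.right_neutral)
  then show ?thesis
    by (simp add: A_def)
qed

lemma answer_factor_nth:
  assumes "i > 0"
  shows "fps_nth (answer_factor i) d = (if i dvd d then answer_weight i (d div i) else 0)"
proof -
  have "(vary - 1) * varx ^ (i\<^sup>2) * varz ^ i =
      fps_X ^ (i\<^sup>2) * fps_const ((fps_X - 1) * fps_const fps_X ^ i)"
    by (simp add: varx_def vary_def varz_def algebra_simps fps_const_power
             flip: fps_const_mult fps_const_sub)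
  then have "fps_nth ((vary - 1) * varx ^ (i\<^sup>2) * varz ^ i) d =
      (if d = i\<^sup>2 then (fps_X - 1) * fps_const fps_X ^ i else 0)"
    by (simp add: fps_X_power_nth)
  moreover have "d = i\<^sup>2 \<longleftrightarrow> i dvd d \<and> d div i = i"
    using assms by (auto simp: power2_eq_square)
  ultimately show ?thesis
    using geometric_factor_nth[OF assms, of d]
    by (auto simp: answer_factor_def answer_weight_def algebra_simps)
qed

section \<open>Tests with bounded answers\<close>

definition bounded_tests :: "nat \<Rightarrow> nat \<Rightarrow> nat multiset set" where
  "bounded_tests m n = {T. set_mset T \<subseteq> {1..m} \<and> cost T = n}"

definition test_weight :: "nat multiset \<Rightarrow> rat fps fps" where
  "test_weight T = fps_X ^ card (valid_answers T) * fps_const fps_X ^ option_count T"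

lemma answer_le_cost: "a \<in># T \<Longrightarrow> a \<le> cost T"
  by (auto simp: cost_def dest: multi_member_split)

text \<open>
  Every answer is positive, so each option adds at least one to the cost. This bound on the size of
  the tests of given cost is what makes their set finite.
\<close>

lemma option_count_le_cost:
  assumes "natural_test T"
  shows "option_count T \<le> cost T"
  using assms by (induction T) (auto simp: natural_test_def cost_def option_count_def)

lemma natural_test_bounded: "T \<in> bounded_tests m n \<Longrightarrow> natural_test T"
  by (auto simp: bounded_tests_def natural_test_def)

lemma finite_bounded_tests: "finite (bounded_tests m n)"
proof (rule finite_subset)
  show "bounded_tests m n \<subseteq> (\<Union>K\<le>n. multisets_of_size {1..m} K)"
  proof
    fix T assume T: "T \<in> bounded_tests m n"
    then have "option_count T \<le> n"
      using option_count_le_cost[OF natural_test_bounded[OF T]] by (simp add: bounded_tests_def)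
    with T show "T \<in> (\<Union>K\<le>n. multisets_of_size {1..m} K)"
      by (auto simp: bounded_tests_def multisets_of_size_def option_count_def)
  qed
  show "finite (\<Union>K\<le>n. multisets_of_size {1..m} K)"
    by (simp add: finite_multisets_of_size)
qed

lemma bounded_tests_eq_natural_tests:
  assumes "n \<le> m"
  shows "bounded_tests m n = {T. natural_test T \<and> cost T = n}"
proof -
  have "a \<le> m" if "a \<in># T" "cost T = n" for a T
    using answer_le_cost[OF that(1)] that(2) assms by linarith
  then show ?thesis
    by (auto simp: bounded_tests_def natural_test_def Suc_le_eq)
qed

lemma test_weight_empty: "test_weight {#} = 1"
proof -
  have "valid_answers {#} = {}"
    by (auto simp: valid_answers_def)
  then show ?thesis
    by (simp add: test_weight_def option_count_def)
qed

lemma bounded_tests_0: "bounded_tests 0 n = (if n = 0 then {{#}} else {})"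
proof -
  have "T \<in> bounded_tests 0 n \<longleftrightarrow> T = {#} \<and> n = 0" for T
    by (auto simp: bounded_tests_def cost_def)
  then show ?thesis
    by (simp add: set_eq_iff)
qed

lemma valid_answers_add_copies:
  assumes "i > 0" "i \<notin># T"
  shows "valid_answers (T + replicate_mset c i) =
    (if c = i then insert i (valid_answers T) else valid_answers T)"
  using assms by (auto simp: valid_answers_def not_in_iff)

text \<open>
  The weight is multiplicative because the copies added are the only ones of their answer: they
  change neither the multiplicity nor the validity of any other answer.
\<close>

lemma test_weight_add_copies:
  assumes "i > 0" "i \<notin># T"
  shows "test_weight (T + replicate_mset c i) = test_weight T * answer_weight i c"
proof -
  have "i \<notin> valid_answers T"
    using assms by (auto simp: valid_answers_def not_in_iff)
  then show ?thesis
    by (simp add: test_weight_def answer_weight_def valid_answers_add_copies[OF assms]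
        finite_valid_answers option_count_def power_add)
qed

text \<open>
  A test with answers up to \<open>m + 1\<close> amounts to the multiplicity \<open>c\<close> of the answer \<open>m + 1\<close> together with
  the remaining test, whose answers are at most \<open>m\<close> and whose cost is smaller by \<open>(m + 1) * c\<close>.
\<close>

lemma sum_bounded_tests_Suc:
  fixes f :: "nat multiset \<Rightarrow> 'a :: comm_monoid_add"
  shows "(\<Sum>T\<in>bounded_tests (Suc m) n. f T) =
    (\<Sum>c | Suc m * c \<le> n. \<Sum>T\<in>bounded_tests m (n - Suc m * c). f (T + replicate_mset c (Suc m)))"
proof -
  have fin: "finite {c. Suc m * c \<le> n}"
    by (rule finite_subset[of _ "{..n}"]) auto
  have copies: "filter_mset (\<lambda>a. a \<noteq> i) T + replicate_mset (count T i) i = T"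
    for i and T :: "nat multiset"
    by (rule multiset_eqI) auto
  have fresh: "Suc m \<notin># T" if "T \<in> bounded_tests m n'" for T n'
    using that by (auto simp: bounded_tests_def)
  have cost_split: "cost (filter_mset (\<lambda>a. a \<noteq> Suc m) T) + Suc m * count T (Suc m) = cost T" for T
    using copies[of "Suc m" T, THEN arg_cong[of _ _ cost]] by (simp add: cost_def mult.commute)
  have "(\<Sum>T\<in>bounded_tests (Suc m) n. f T) =
      (\<Sum>(c, T)\<in>Sigma {c. Suc m * c \<le> n} (\<lambda>c. bounded_tests m (n - Suc m * c)).
        f (T + replicate_mset c (Suc m)))"
  proof (rule sum.reindex_bij_witness[of _ "\<lambda>(c, T). T + replicate_mset c (Suc m)"
        "\<lambda>T. (count T (Suc m), filter_mset (\<lambda>a. a \<noteq> Suc m) T)"], goal_cases)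
    case (1 T)
    show ?case using copies by simp
  next
    case (2 T)
    show ?case
      using 2 cost_split[of T] by (fastforce simp: bounded_tests_def le_Suc_eq)
  next
    case (3 p)
    then show ?case
      using fresh by (auto simp: not_in_iff intro!: multiset_eqI)
  next
    case (4 p)
    then show ?case
      by (fastforce simp: bounded_tests_def cost_def algebra_simps)
  next
    case (5 T)
    show ?case using copies by simp
  qed
  also have "\<dots> = (\<Sum>c | Suc m * c \<le> n. \<Sum>T\<in>bounded_tests m (n - Suc m * c).
      f (T + replicate_mset c (Suc m)))"
    by (rule sum.Sigma[symmetric]) (auto simp: finite_bounded_tests fin simp del: mult_Suc)
  finally show ?thesis .
qed

section \<open>Partial products and their limit\<close>

text \<open>
  In the induction step, the Cauchy product with the factor of \<open>m + 1\<close> runs over the multiples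
  \<open>(m + 1) * c\<close> only, and its summand for \<open>c\<close> collects the tests with exactly \<open>c\<close> answers \<open>m + 1\<close>.
\<close>

lemma partial_product_nth:
  "fps_nth (\<Prod>j<m. answer_factor (Suc j)) n = (\<Sum>T\<in>bounded_tests m n. test_weight T)"
proof (induction m arbitrary: n)
  case 0
  show ?case
    by (cases "n = 0") (simp_all add: bounded_tests_0 test_weight_empty)
next
  case (Suc m)
  let ?i = "Suc m" and ?P = "\<Prod>j<m. answer_factor (Suc j)"
  have "fps_nth (\<Prod>j<Suc m. answer_factor (Suc j)) n =
      (\<Sum>d=0..n. fps_nth (answer_factor ?i) d * fps_nth ?P (n - d))"
    by (simp only: prod.lessThan_Suc mult.commute[of ?P] fps_mult_nth)
  also have "\<dots> = (\<Sum>d | d \<le> n \<and> ?i dvd d. answer_weight ?i (d div ?i) * fps_nth ?P (n - d))"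
    by (rule sum.mono_neutral_cong_right) (auto simp: answer_factor_nth)
  also have "\<dots> = (\<Sum>c | ?i * c \<le> n. answer_weight ?i c * fps_nth ?P (n - ?i * c))"
    by (rule sum.reindex_bij_witness[of _ "\<lambda>c. ?i * c" "\<lambda>d. d div ?i"])
       (auto simp del: mult_Suc)
  also have "\<dots> = (\<Sum>c | ?i * c \<le> n. \<Sum>T\<in>bounded_tests m (n - ?i * c).
      test_weight (T + replicate_mset c ?i))"
  proof (intro sum.cong refl)
    fix c
    have "test_weight (T + replicate_mset c ?i) = answer_weight ?i c * test_weight T"
      if "T \<in> bounded_tests m n'" for T n'
      using that by (subst test_weight_add_copies) (auto simp: bounded_tests_def mult.commute)
    then show "answer_weight ?i c * fps_nth ?P (n - ?i * c) =
        (\<Sum>T\<in>bounded_tests m (n - ?i * c). test_weight (T + replicate_mset c ?i))"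
      by (simp add: Suc.IH sum_distrib_left del: mult_Suc)
  qed
  also have "\<dots> = (\<Sum>T\<in>bounded_tests ?i n. test_weight T)"
    by (rule sum_bounded_tests_Suc[symmetric])
  finally show ?case .
qed

lemma test_weight_nth:
  "fps_nth (fps_nth (test_weight T) k) K =
    (if card (valid_answers T) = k \<and> option_count T = K then 1 else 0)"
  by (auto simp: test_weight_def fps_const_power fps_X_power_mult_nth fps_X_power_nth)

lemma tests_gf_nth_eq_sum_weights:
  assumes "n \<le> m"
  shows "fps_nth tests_gf n = (\<Sum>T\<in>bounded_tests m n. test_weight T)"
proof (intro fps_ext)
  fix k K
  have "bounded_tests m n \<inter> {T. card (valid_answers T) = k \<and> option_count T = K} = tests n k K"
    by (auto simp: bounded_tests_eq_natural_tests[OF assms] tests_def)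
  then show "fps_nth (fps_nth (fps_nth tests_gf n) k) K =
      fps_nth (fps_nth (\<Sum>T\<in>bounded_tests m n. test_weight T) k) K"
    by (simp add: tests_gf_nth fps_sum_nth test_weight_nth num_tests_def finite_bounded_tests
        sum.If_cases)
qed

text \<open>
  The limit of the partial products of an infinite product must not vanish unless a factor does;
  here the empty test contributes the constant coefficient.
\<close>

lemma tests_gf_nonzero: "tests_gf \<noteq> 0"
proof -
  have "fps_nth tests_gf 0 = 1"
    using tests_gf_nth_eq_sum_weights[of 0 0] by (simp add: bounded_tests_0 test_weight_empty)
  then show ?thesis
    by auto
qed

theorem theorem2:
  shows "(\<lambda>j. let i = Suc j in
            1 / (1 - varx ^ i * varz) + (vary - 1) * varx ^ (i\<^sup>2) * varz ^ i) has_prod tests_gf"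
proof -
  have "(\<lambda>m. \<Prod>j\<le>m. answer_factor (Suc j)) \<longlonglongrightarrow> tests_gf"
  proof (rule tendsto_fpsI)
    fix n
    show "\<forall>\<^sub>F m in sequentially. fps_nth (\<Prod>j\<le>m. answer_factor (Suc j)) n = fps_nth tests_gf n"
      using eventually_ge_at_top[of n]
    proof eventually_elim
      case (elim m)
      then show ?case
        using partial_product_nth[of "Suc m" n] tests_gf_nth_eq_sum_weights[of n "Suc m"]
        by (simp add: lessThan_Suc_atMost del: prod.lessThan_Suc)
    qed
  qed
  then show ?thesis
    unfolding has_prod_def raw_has_prod_def Let_def answer_factor_def[symmetric]
    using tests_gf_nonzero by simp
qed

end
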